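(* Let $S_{\boldsymbol{\lambda}}$ be a contractive weighted shift on the directed tree $\mathcal{T}=(V,E)$. Then: (i) If $\mathcal{T}$ has a root, then $S_{\boldsymbol{\lambda}}^*$ is stable. (ii) If $\mathcal{T}$ is rootless, then $$h_u:=\sum_{v\in\mathrm{Gen}(u)}\ \prod_{j=0}^\infty\lambda_{\mathrm{par}^j(v)}\cdot e_v\in\ell^2(V)\qquad(u\in V),$$ and $(\mathcal{H}_0^* )^\perp$ is the closed linear span of $\{h_u\colon u\in V\}$. If $h_u\neq0$ for some $u\in V$, then $h_u\ne0$ for every $u\in V$. Moreover, in this case $h_u=h_v$ if and only if $u\in\mathrm{Gen}(v)$, and the vectors $h_u$ are eigenvectors of the asymptotic limit $A_*$ of $S_{\boldsymbol{\lambda}}^*$: $$A_*h_u=a_uh_u\qquad(u\in V)$$ with the corresponding eigenvalues $$a_u:=\|h_u\|^2=\sum_{v\in\mathrm{Gen}(u)}\prod_{j=0}^\infty\lambda_{\mathrm{par}^j(v)}^2.$$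
   Context: A directed tree $\mathcal{T}=(V,E)$ consists of a non-empty vertex set $V$ and an edge set $E\subseteq V\times V\setminus\{(v,v)\colon v\in V\}$ such that there are no directed circuits, the underlying undirected graph is connected, and each vertex $v$ has at most one parent, i.e. at most one $u$ with $(u,v)\in E$; this $u$ is denoted $\mathrm{par}(v)$. A vertex without a parent is a root; there is at most one. $V^\circ$ is $V$ minus the root if a root exists, and $V^\circ=V$ otherwise. $\mathrm{Chi}(u)=\{v\colon(u,v)\in E\}$; $\mathrm{Chi}(W)=\bigcup_{v\in W}\mathrm{Chi}(v)$, $\mathrm{Chi}^0(W)=W$, $\mathrm{Chi}^{n+1}(W)=\mathrm{Chi}(\mathrm{Chi}^n(W))$, $\mathrm{Chi}^n(u)=\mathrm{Chi}^n(\{u\})$; $\mathrm{par}^k$ is the $k$-fold iterate of $\mathrm{par}$ where defined, $\mathrm{par}^0$ the identity. In a rootless tree, $\mathrm{Gen}(u)=\bigcup_{n=0}^\infty\mathrm{Chi}^n(\mathrm{par}^n(u))$ is the generation (level) of $u$. $\ell^2(V)$ is the complex Hilbert space of square-summable functions on $V$ with orthonormal basis $\{e_u\}_{u\in V}$. Given weights $\boldsymbol{\lambda}=\{\lambda_v\colon v\in V^\circ\}\subseteq(0,\infty)$ with $\sup_{u\in V}\sum_{v\in\mathrm{Chi}(u)}\lambda_v^2<\infty$, the weighted shift $S_{\boldsymbol{\lambda}}$ on $\mathcal{T}$ is the bounded operator on $\ell^2(V)$ with $S_{\boldsymbol{\lambda}}e_u=\sum_{v\in\mathrm{Chi}(u)}\lambda_ve_v$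 (all weights are assumed positive). It is contractive if $\|S_{\boldsymbol{\lambda}}\|\le1$; then all weights lie in $(0,1]$ and the infinite products are limits of decreasing partial products, possibly $0$. A contraction $T$ on a Hilbert space $\mathcal{H}$ is stable if $\|T^nh\|\to0$ for all $h\in\mathcal{H}$. $\mathcal{H}_0^*=\{h\in\ell^2(V)\colon\lim_{n}\|S_{\boldsymbol{\lambda}}^{*n}h\|=0\}$ is the stable subspace of $S_{\boldsymbol{\lambda}}^*$. $A_*=\lim_{n\to\infty}S_{\boldsymbol{\lambda}}^nS_{\boldsymbol{\lambda}}^{*n}$ in the strong operator topology (the limit exists). *)

theory Defs
  imports "HOL-Analysis.Analysis"
begin

section \<open>The complex Hilbert space of square-summable functions\<close>

text \<open>The index set is the whole type \<open>'v\<close>, which later serves as the vertex set.\<close>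

definition square_summable :: "('v \<Rightarrow> complex) \<Rightarrow> bool" where
  "square_summable f \<longleftrightarrow> (\<lambda>v. (cmod (f v))\<^sup>2) summable_on UNIV"

lemma square_summable_zero: "square_summable (\<lambda>v. 0)"
  by (simp add: square_summable_def)

lemma square_summable_scale:
  assumes "square_summable f"
  shows "square_summable (\<lambda>v. c * f v)"
  using assms unfolding square_summable_def
  by (auto simp: norm_mult power_mult_distrib intro: summable_on_cmult_right)

lemma square_summable_add:
  assumes "square_summable f" "square_summable g"
  shows "square_summable (\<lambda>v. f v + g v)"
  unfolding square_summable_def
proof (rule summable_on_comparison_test)
  show "(\<lambda>v. 2 * (cmod (f v))\<^sup>2 + 2 * (cmod (g v))\<^sup>2) summable_on UNIV"
    using assms unfolding square_summable_def
    by (intro summable_on_add summable_on_cmult_right)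
  show "(cmod (f v + g v))\<^sup>2 \<le> 2 * (cmod (f v))\<^sup>2 + 2 * (cmod (g v))\<^sup>2" for v
  proof -
    have "(cmod (f v + g v))\<^sup>2 \<le> (cmod (f v) + cmod (g v))\<^sup>2"
      by (intro power_mono norm_triangle_ineq) simp
    also have "\<dots> \<le> 2 * (cmod (f v))\<^sup>2 + 2 * (cmod (g v))\<^sup>2"
      using zero_le_power2[of "cmod (f v) - cmod (g v)"]
      by (simp add: power2_sum power2_diff)
    finally show ?thesis .
  qed
qed auto

lemma summable_on_mult_cnj:
  assumes "square_summable f" "square_summable g"
  shows "(\<lambda>v. f v * cnj (g v)) summable_on UNIV"
proof (rule abs_summable_summable, rule summable_on_comparison_test)
  show "(\<lambda>v. (cmod (f v))\<^sup>2 + (cmod (g v))\<^sup>2) summable_on UNIV"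
    using assms unfolding square_summable_def by (intro summable_on_add)
  show "cmod (f v * cnj (g v)) \<le> (cmod (f v))\<^sup>2 + (cmod (g v))\<^sup>2" for v
    using zero_le_power2[of "cmod (f v) - cmod (g v)"]
      mult_nonneg_nonneg[of "cmod (f v)" "cmod (g v)"]
    by (simp add: norm_mult power2_diff del: mult_nonneg_nonneg)
qed auto

typedef 'v ell2 = "{f :: 'v \<Rightarrow> complex. square_summable f}"
  morphisms ell2_fun Abs_ell2
  using square_summable_zero by blast

setup_lifting type_definition_ell2

lemma square_summable_ell2_fun: "square_summable (ell2_fun f)"
  using ell2_fun by auto

lift_definition cinner :: "'v ell2 \<Rightarrow> 'v ell2 \<Rightarrow> complex"
  is "\<lambda>f g. \<Sum>\<^sub>\<infinity>v. f v * cnj (g v)" .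

lift_definition scaleC :: "complex \<Rightarrow> 'v ell2 \<Rightarrow> 'v ell2"  (infixr \<open>*\<^sub>C\<close> 75)
  is "\<lambda>c f v. c * f v"
  by (rule square_summable_scale)

text \<open>The type class of real inner product spaces is instantiated with the real part of
  \<open>cinner\<close>; it induces the same norm and topology.\<close>

instantiation ell2 :: (type) real_inner
begin

lift_definition zero_ell2 :: "'a ell2" is "\<lambda>v. 0"
  by (rule square_summable_zero)

lift_definition plus_ell2 :: "'a ell2 \<Rightarrow> 'a ell2 \<Rightarrow> 'a ell2" is "\<lambda>f g v. f v + g v"
  by (rule square_summable_add)

lift_definition uminus_ell2 :: "'a ell2 \<Rightarrow> 'a ell2" is "\<lambda>f v. - f v"
  by (simp add: square_summable_def)

definition minus_ell2 :: "'a ell2 \<Rightarrow> 'a ell2 \<Rightarrow> 'a ell2" where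
  "f - g = f + (- g)" for f g :: "'a ell2"

definition scaleR_ell2 :: "real \<Rightarrow> 'a ell2 \<Rightarrow> 'a ell2" where
  "r *\<^sub>R f = complex_of_real r *\<^sub>C f" for f :: "'a ell2"

definition inner_ell2 :: "'a ell2 \<Rightarrow> 'a ell2 \<Rightarrow> real" where
  "inner f g = Re (cinner f g)" for f g :: "'a ell2"

lift_definition norm_ell2 :: "'a ell2 \<Rightarrow> real"
  is "\<lambda>f. sqrt (\<Sum>\<^sub>\<infinity>v. (cmod (f v))\<^sup>2)" .

definition dist_ell2 :: "'a ell2 \<Rightarrow> 'a ell2 \<Rightarrow> real" where
  "dist f g = norm (f - g)" for f g :: "'a ell2"

definition sgn_ell2 :: "'a ell2 \<Rightarrow> 'a ell2" where
  "sgn f = inverse (norm f) *\<^sub>R f" for f :: "'a ell2"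

definition uniformity_ell2 :: "('a ell2 \<times> 'a ell2) filter" where
  "uniformity_ell2 = (INF e\<in>{0<..}. principal {(f, g). dist f g < e})"

definition open_ell2 :: "'a ell2 set \<Rightarrow> bool" where
  "open_ell2 U \<longleftrightarrow> (\<forall>f\<in>U. eventually (\<lambda>(f', g). f' = f \<longrightarrow> g \<in> U) uniformity)"

instance
proof
  fix f g h :: "'a ell2" and r s :: real
  show "f + g + h = f + (g + h)" by transfer (simp add: add.assoc)
  show "f + g = g + f" by transfer (simp add: add.commute)
  show "0 + f = f" by transfer simp
  show "- f + f = 0" by transfer simp
  show "f - g = f + - g" by (simp add: minus_ell2_def)
  show "r *\<^sub>R (f + g) = r *\<^sub>R f + r *\<^sub>R g"
    unfolding scaleR_ell2_def by transfer (simp add: algebra_simps)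
  show "(r + s) *\<^sub>R f = r *\<^sub>R f + s *\<^sub>R f"
    unfolding scaleR_ell2_def by transfer (simp add: algebra_simps)
  show "r *\<^sub>R s *\<^sub>R f = (r * s) *\<^sub>R f"
    unfolding scaleR_ell2_def by transfer (simp add: algebra_simps)
  show "1 *\<^sub>R f = f"
    unfolding scaleR_ell2_def by transfer simp
  show "dist f g = norm (f - g)" by (simp add: dist_ell2_def)
  show "sgn f = inverse (norm f) *\<^sub>R f" by (simp add: sgn_ell2_def)
  show "(uniformity :: ('a ell2 \<times> 'a ell2) filter) = (INF e\<in>{0<..}. principal {(f, g). dist f g < e})"
    by (simp add: uniformity_ell2_def)
  show "open U \<longleftrightarrow> (\<forall>f\<in>U. \<forall>\<^sub>F (f', g) in uniformity. f' = f \<longrightarrow> g \<in> U)"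
    for U :: "'a ell2 set"
    by (simp add: open_ell2_def)
  have "cinner g f = cnj (cinner f g)"
    by transfer (simp add: mult.commute flip: infsum_cnj)
  then show "inner f g = inner g f"
    by (simp add: inner_ell2_def)
  have "cinner (f + g) h = cinner f h + cinner g h"
    by transfer (simp add: distrib_right infsum_add summable_on_mult_cnj)
  then show "inner (f + g) h = inner f h + inner g h"
    by (simp add: inner_ell2_def)
  have "cinner (c *\<^sub>C f) g = c * cinner f g" for c
    by transfer (simp add: mult.assoc infsum_cmult_right')
  then show "inner (r *\<^sub>R f) g = r * inner f g"
    by (simp add: inner_ell2_def scaleR_ell2_def)
  have eq: "inner f f = (\<Sum>\<^sub>\<infinity>v. (cmod (ell2_fun f v))\<^sup>2)"
  proof -
    have "inner f f = (\<Sum>\<^sub>\<infinity>v. Re (ell2_fun f v * cnj (ell2_fun f v)))"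
      unfolding inner_ell2_def cinner.rep_eq
      by (rule infsum_Re[symmetric])
        (rule summable_on_mult_cnj[OF square_summable_ell2_fun square_summable_ell2_fun])
    then show ?thesis
      by (simp only: complex_norm_square[symmetric] Re_complex_of_real)
  qed
  show "0 \<le> inner f f"
    by (simp add: eq infsum_nonneg)
  show "norm f = sqrt (inner f f)"
    by (simp add: eq norm_ell2.rep_eq)
  show "inner f f = 0 \<longleftrightarrow> f = 0"
  proof
    assume "inner f f = 0"
    then have "(cmod (ell2_fun f v))\<^sup>2 = 0" for v
      using square_summable_ell2_fun[of f] unfolding square_summable_def eq
      by (intro nonneg_infsum_le_0D[where A = UNIV and f = "\<lambda>v. (cmod (ell2_fun f v))\<^sup>2"]) auto
    then show "f = 0"
      by (simp add: ell2_fun_inject[symmetric] zero_ell2.rep_eq fun_eq_iff)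
  qed (simp add: inner_ell2_def cinner.rep_eq zero_ell2.rep_eq)
qed

end

global_interpretation complex_ell2: vector_space "scaleC :: complex \<Rightarrow> 'v ell2 \<Rightarrow> 'v ell2"
  by standard (transfer; simp add: algebra_simps)+

lift_definition ket :: "'v \<Rightarrow> 'v ell2" is "\<lambda>u v. if v = u then 1 else 0"
proof -
  show "square_summable (\<lambda>v. if v = u then 1 else 0)" for u :: 'v
    unfolding square_summable_def
    by (rule summable_on_cong_neutral[where T = "{u}", THEN iffD2, rotated 3])
      auto
qed

section \<open>Operators\<close>

definition bounded_clinear :: "('v ell2 \<Rightarrow> 'w ell2) \<Rightarrow> bool" where
  "bounded_clinear T \<longleftrightarrow> bounded_linear T \<and> (\<forall>c f. T (c *\<^sub>C f) = c *\<^sub>C T f)"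

definition contraction :: "('v ell2 \<Rightarrow> 'v ell2) \<Rightarrow> bool" where
  "contraction T \<longleftrightarrow> bounded_clinear T \<and> onorm T \<le> 1"

definition cadjoint :: "('v ell2 \<Rightarrow> 'v ell2) \<Rightarrow> 'v ell2 \<Rightarrow> 'v ell2" where
  "cadjoint T = (THE T'. \<forall>f g. cinner (T f) g = cinner f (T' g))"

definition stable_subspace :: "('v ell2 \<Rightarrow> 'v ell2) \<Rightarrow> 'v ell2 set" where
  "stable_subspace T = {h. (\<lambda>n. norm ((T ^^ n) h)) \<longlonglongrightarrow> 0}"

definition is_stable :: "('v ell2 \<Rightarrow> 'v ell2) \<Rightarrow> bool" where
  "is_stable T \<longleftrightarrow> contraction T \<and> (\<forall>h. (\<lambda>n. norm ((T ^^ n) h)) \<longlonglongrightarrow> 0)"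

definition orth_compl :: "'v ell2 set \<Rightarrow> 'v ell2 set" where
  "orth_compl M = {g. \<forall>f\<in>M. cinner f g = 0}"

text \<open>The asymptotic limit of \<open>cadjoint S\<close>: the limit of \<open>S\<^sup>n S\<^sup>*\<^sup>n\<close> in the strong operator
  topology.\<close>

definition asymptotic_limit_adj :: "('v ell2 \<Rightarrow> 'v ell2) \<Rightarrow> 'v ell2 \<Rightarrow> 'v ell2" where
  "asymptotic_limit_adj S h = lim (\<lambda>n. (S ^^ n) ((cadjoint S ^^ n) h))"

section \<open>Directed trees\<close>

text \<open>The vertex set is \<open>UNIV :: 'v set\<close>, which is non-empty.\<close>

definition directed_tree :: "('v \<times> 'v) set \<Rightarrow> bool" where
  "directed_tree E \<longleftrightarrow>
     irrefl E \<and> acyclic E \<and>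
     (\<forall>u v. (u, v) \<in> (E \<union> E\<inverse>)\<^sup>*) \<and>
     (\<forall>u u' v. (u, v) \<in> E \<longrightarrow> (u', v) \<in> E \<longrightarrow> u = u')"

definition is_root :: "('v \<times> 'v) set \<Rightarrow> 'v \<Rightarrow> bool" where
  "is_root E v \<longleftrightarrow> \<not> (\<exists>u. (u, v) \<in> E)"

text \<open>\<open>parent E v\<close> is unspecified if \<open>v\<close> is a root; below, it and its iterates are
  used only for rootless trees.\<close>

definition parent :: "('v \<times> 'v) set \<Rightarrow> 'v \<Rightarrow> 'v" where
  "parent E v = (THE u. (u, v) \<in> E)"

definition children :: "('v \<times> 'v) set \<Rightarrow> 'v \<Rightarrow> 'v set" where
  "children E u = {v. (u, v) \<in> E}"

definition children_set :: "('v \<times> 'v) set \<Rightarrow> 'v set \<Rightarrow> 'v set" where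
  "children_set E W = (\<Union>v\<in>W. children E v)"

definition generation :: "('v \<times> 'v) set \<Rightarrow> 'v \<Rightarrow> 'v set" where
  "generation E u = (\<Union>n. (children_set E ^^ n) {(parent E ^^ n) u})"

section \<open>Weighted shifts\<close>

text \<open>Only the weights at non-root vertices matter. For a vertex with infinitely many children
  the series defining the image of the basis vector \<open>ket u\<close> converges in norm.\<close>

definition weighted_shift ::
  "('v \<times> 'v) set \<Rightarrow> ('v \<Rightarrow> real) \<Rightarrow> ('v ell2 \<Rightarrow> 'v ell2) \<Rightarrow> bool" where
  "weighted_shift E lam S \<longleftrightarrow>
     (\<forall>v. \<not> is_root E v \<longrightarrow> 0 < lam v) \<and>
     (\<forall>u. (\<lambda>v. (lam v)\<^sup>2) summable_on children E u) \<and>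
     bdd_above (range (\<lambda>u. \<Sum>\<^sub>\<infinity>v\<in>children E u. (lam v)\<^sup>2)) \<and>
     bounded_clinear S \<and>
     (\<forall>u. ((\<lambda>v. complex_of_real (lam v) *\<^sub>C ket v) has_sum S (ket u)) (children E u))"

text \<open>The infinite product as the limit of its partial products, which may be \<open>0\<close>. The
  library's \<open>prodinf\<close> is not suitable here: it treats a product of non-zero factors with limit
  \<open>0\<close> as divergent.\<close>

definition limit_prod :: "(nat \<Rightarrow> real) \<Rightarrow> real" where
  "limit_prod a = lim (\<lambda>n. \<Prod>j<n. a j)"

definition hvec_term :: "('v \<times> 'v) set \<Rightarrow> ('v \<Rightarrow> real) \<Rightarrow> 'v \<Rightarrow> 'v ell2" where
  "hvec_term E lam v = complex_of_real (limit_prod (\<lambda>j. lam ((parent E ^^ j) v))) *\<^sub>C ket v"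

definition hvec :: "('v \<times> 'v) set \<Rightarrow> ('v \<Rightarrow> real) \<Rightarrow> 'v \<Rightarrow> 'v ell2" where
  "hvec E lam u = (\<Sum>\<^sub>\<infinity>v\<in>generation E u. hvec_term E lam v)"

end

theory Submission
  imports Defs
begin

text \<open>
  If there is a root, every basis vector is annihilated by a power of the adjoint. In a rootless tree let \<open>P\<^sub>n(v)\<close> be the product of the weights of the first \<open>n\<close> vertices on the path
  from \<open>v\<close> upwards, and \<open>P(v)\<close> its limit. The adjoint power \<open>S\<^sup>*\<^sup>n\<close> sends \<open>e\<^sub>v\<close> to \<open>P\<^sub>n(v)\<close> times the
  basis vector of the \<open>n\<close>-th ancestor \<open>x\<close> of \<open>v\<close>. If \<open>P(v) \<noteq> 0\<close>, then \<open>S\<^sup>n e\<^sub>x\<close> is the part of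
  \<open>h\<^sub>v\<close> below \<open>x\<close> divided by \<open>P(x)\<close>, and \<open>P(x)\<close> tends to \<open>1\<close>. Hence \<open>S\<^sup>n S\<^sup>*\<^sup>n e\<^sub>v\<close> tends to
  \<open>P(v) h\<^sub>v\<close>, which is trivial if \<open>P(v) = 0\<close>. Since all operators are contractions, this determines
  the limit at \<open>h\<^sub>u\<close> and identifies the stable subspace as the orthogonal complement of the
  \<open>h\<^sub>u\<close>. A vector in the double complement is on each generation a multiple of \<open>h\<^sub>u\<close>, so it is
  approximated by its restrictions to finitely many generations; completeness of the space is not
  needed.
\<close>

section \<open>Square-summable functions\<close>

lemma ell2_eqI: "(\<And>v. ell2_fun f v = ell2_fun g v) \<Longrightarrow> f = g"
  by (simp add: ell2_fun_inject[symmetric] fun_eq_iff)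

lemma ell2_fun_minus: "ell2_fun (f - g) v = ell2_fun f v - ell2_fun g v"
  unfolding minus_ell2_def plus_ell2.rep_eq uminus_ell2.rep_eq by simp

lemma norm_ell2_square: "(norm f)\<^sup>2 = (\<Sum>\<^sub>\<infinity>v. (cmod (ell2_fun f v))\<^sup>2)"
  by (simp add: norm_ell2.rep_eq infsum_nonneg)

lemma summable_norm_ell2: "(\<lambda>v. (cmod (ell2_fun f v))\<^sup>2) summable_on UNIV"
  using square_summable_ell2_fun square_summable_def by blast

lemma summable_cinner: "(\<lambda>v. ell2_fun f v * cnj (ell2_fun g v)) summable_on UNIV"
  by (intro summable_on_mult_cnj square_summable_ell2_fun)

lemma cinner_commute: "cinner g f = cnj (cinner f g)"
  by (simp add: cinner.rep_eq mult.commute flip: infsum_cnj)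

lemma cinner_add_left: "cinner (f + g) h = cinner f h + cinner g h"
  by (simp add: cinner.rep_eq plus_ell2.rep_eq distrib_right infsum_add summable_cinner)

lemma cinner_scale_left: "cinner (c *\<^sub>C f) g = c * cinner f g"
  by (simp add: cinner.rep_eq scaleC.rep_eq mult.assoc infsum_cmult_right')

lemma cinner_add_right: "cinner h (f + g) = cinner h f + cinner h g"
  by (metis cinner_add_left cinner_commute complex_cnj_add)

lemma cinner_scale_right: "cinner g (c *\<^sub>C f) = cnj c * cinner g f"
  by (metis cinner_scale_left cinner_commute complex_cnj_mult)

lemma cinner_zero_right [simp]: "cinner f 0 = 0"
  by (simp add: cinner.rep_eq zero_ell2.rep_eq)

lemma cinner_zero_left [simp]: "cinner 0 f = 0"
  by (simp add: cinner.rep_eq zero_ell2.rep_eq)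

lemma cinner_self: "cinner f f = complex_of_real ((norm f)\<^sup>2)"
proof -
  have "cinner f f = (\<Sum>\<^sub>\<infinity>v. complex_of_real ((cmod (ell2_fun f v))\<^sup>2))"
    by (simp only: cinner.rep_eq complex_norm_square)
  also have "\<dots> = complex_of_real (\<Sum>\<^sub>\<infinity>v. (cmod (ell2_fun f v))\<^sup>2)"
    by (rule infsumI) (intro has_sum_of_real has_sum_infsum summable_norm_ell2)
  finally show ?thesis
    by (simp only: norm_ell2_square)
qed

lemma norm_scaleC: "norm (c *\<^sub>C f) = cmod c * norm f" for f :: "'v ell2"
proof -
  have "(norm (c *\<^sub>C f))\<^sup>2 = (cmod c * norm f)\<^sup>2"
    by (simp add: norm_ell2_square scaleC.rep_eq norm_mult power_mult_distrib infsum_cmult_right')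
  then show ?thesis
    by (simp add: power2_eq_iff_nonneg)
qed

text \<open>Cauchy-Schwarz for the real part, applied after rotating \<open>f\<close> by a
  unimodular scalar that turns the complex inner product into its modulus.\<close>

lemma cmod_cinner_le: "cmod (cinner f g) \<le> norm f * norm g"
proof -
  obtain c where c: "cmod c = 1" "c * cinner f g = complex_of_real (cmod (cinner f g))"
  proof (cases "cinner f g = 0")
    case False
    show ?thesis
      by (rule that[of "cnj (sgn (cinner f g))"])
        (use False in \<open>simp_all add: norm_sgn sgn_eq norm_divide mult.commute power2_eq_square
          flip: complex_norm_square\<close>)
  qed (use that[of 1] in simp)
  have "cmod (cinner f g) = inner (c *\<^sub>C f) g"
    using c by (simp add: inner_ell2_def cinner_scale_left)
  also have "\<dots> \<le> norm (c *\<^sub>C f) * norm g"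
    by (rule norm_cauchy_schwarz)
  finally show ?thesis
    using c by (simp add: norm_scaleC)
qed

section \<open>Basis vectors as coordinate functionals\<close>

lemma ell2_fun_ket: "ell2_fun (ket u) v = (if v = u then 1 else 0)"
  by (simp add: ket.rep_eq)

lemma cinner_ket_left: "cinner (ket u) f = cnj (ell2_fun f u)"
proof -
  have "cinner (ket u) f = (\<Sum>\<^sub>\<infinity>v\<in>{u}. ell2_fun (ket u) v * cnj (ell2_fun f v))"
    unfolding cinner.rep_eq by (rule infsum_cong_neutral) (auto simp: ell2_fun_ket)
  then show ?thesis
    by (simp add: ell2_fun_ket)
qed

lemma cinner_ket_right: "cinner f (ket u) = ell2_fun f u"
  by (metis cinner_commute cinner_ket_left complex_cnj_cnj)

lemma cinner_ext:
  assumes "\<And>f. cinner f x = cinner f y"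
  shows "x = y"
  using assms by (metis cinner_commute cinner_ket_right ell2_eqI)

lemma norm_ket [simp]: "norm (ket u) = 1"
proof -
  have "complex_of_real ((norm (ket u))\<^sup>2) = 1"
    by (simp only: cinner_self[symmetric] cinner_ket_left) (simp add: ell2_fun_ket)
  then show ?thesis
    by (simp add: power2_eq_1_iff flip: of_real_power) (smt (verit) norm_ge_zero)
qed

lemma bounded_linear_ell2_fun: "bounded_linear (\<lambda>f. ell2_fun f v)"
proof (rule bounded_linear_intro)
  show "norm (ell2_fun f v) \<le> norm f * 1" for f
    using cmod_cinner_le[of f "ket v"] by (simp add: cinner_ket_right)
qed (auto simp: plus_ell2.rep_eq scaleR_ell2_def scaleC.rep_eq scaleR_conv_of_real)

lemma bounded_linear_cinner_left: "bounded_linear (\<lambda>f. cinner f g)"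
  by (rule bounded_linear_intro[where K = "norm g"])
    (auto simp: cinner_add_left scaleR_ell2_def cinner_scale_left scaleR_conv_of_real cmod_cinner_le)

lemma bounded_linear_cinner_right: "bounded_linear (cinner f)"
  by (rule bounded_linear_intro[where K = "norm f"])
    (auto simp: cinner_add_right scaleR_ell2_def cinner_scale_right scaleR_conv_of_real
      cmod_cinner_le mult.commute[of "norm _" "norm f"])

lemma cinner_diff_left: "cinner (f - g) h = cinner f h - cinner g h"
  by (rule linear_diff[OF bounded_linear.linear[OF bounded_linear_cinner_left]])

lemma cinner_diff_right: "cinner h (f - g) = cinner h f - cinner h g"
  by (rule linear_diff[OF bounded_linear.linear[OF bounded_linear_cinner_right]])

text \<open>Lets scalar and vector pass to their limits simultaneously, as happens in
  \<open>asym_ket\<close>.\<close>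

lemma bounded_bilinear_scaleC: "bounded_bilinear (scaleC :: complex \<Rightarrow> 'v ell2 \<Rightarrow> 'v ell2)"
proof
  show "\<exists>K. \<forall>c (f :: 'v ell2). norm (c *\<^sub>C f) \<le> norm c * norm f * K"
    by (rule exI[of _ 1]) (simp add: norm_scaleC)
qed (simp_all add: complex_ell2.scale_right_distrib complex_ell2.scale_left_distrib scaleR_ell2_def
    scaleR_conv_of_real mult.commute)

section \<open>Restriction to sets of vertices and approximation by finite supports\<close>

lift_definition restrict_ell2 :: "'v set \<Rightarrow> 'v ell2 \<Rightarrow> 'v ell2"
  is "\<lambda>W f v. if v \<in> W then f v else 0"
proof -
  fix W and f :: "'v \<Rightarrow> complex"
  assume "square_summable f"
  then show "square_summable (\<lambda>v. if v \<in> W then f v else 0)"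
    unfolding square_summable_def by (rule summable_on_comparison_test) auto
qed

lemma restrict_ell2_add: "restrict_ell2 W (f + g) = restrict_ell2 W f + restrict_ell2 W g"
  by (rule ell2_eqI) (simp add: restrict_ell2.rep_eq plus_ell2.rep_eq)

lemma restrict_ell2_compl: "f - restrict_ell2 W f = restrict_ell2 (- W) f"
  by (rule ell2_eqI) (simp add: restrict_ell2.rep_eq ell2_fun_minus)

lemma restrict_ell2_scale_ket:
  "restrict_ell2 W (c *\<^sub>C ket v) = (if v \<in> W then c *\<^sub>C ket v else 0)"
  by (rule ell2_eqI) (simp add: restrict_ell2.rep_eq scaleC.rep_eq zero_ell2.rep_eq ell2_fun_ket)

lemma norm_restrict_ell2: "(norm (restrict_ell2 W f))\<^sup>2 = (\<Sum>\<^sub>\<infinity>v\<in>W. (cmod (ell2_fun f v))\<^sup>2)"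
  unfolding norm_ell2_square
  by (rule infsum_cong_neutral) (auto simp: restrict_ell2.rep_eq)

lemma norm_restrict_ell2_mono:
  assumes "W \<subseteq> W'"
  shows "norm (restrict_ell2 W f) \<le> norm (restrict_ell2 W' f)"
proof -
  have "(norm (restrict_ell2 W f))\<^sup>2 \<le> (norm (restrict_ell2 W' f))\<^sup>2"
    unfolding norm_restrict_ell2 using assms
    by (intro infsum_mono2) (auto intro: summable_on_subset_banach[OF summable_norm_ell2])
  then show ?thesis
    by (simp add: power2_le_iff_abs_le)
qed

lemma restrict_ell2_UNIV [simp]: "restrict_ell2 UNIV f = f"
  by (rule ell2_eqI) (simp add: restrict_ell2.rep_eq)

lemma norm_restrict_ell2_le: "norm (restrict_ell2 W f) \<le> norm f"
  using norm_restrict_ell2_mono[of W UNIV f] by simp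

lemma sum_ket_restrict:
  assumes "finite F"
  shows "(\<Sum>v\<in>F. ell2_fun f v *\<^sub>C ket v) = restrict_ell2 F f"
  using assms
proof induction
  case empty
  show ?case
    by (rule ell2_eqI) (simp add: restrict_ell2.rep_eq zero_ell2.rep_eq)
next
  case (insert x F)
  then show ?case
    by (intro ell2_eqI)
      (auto simp: restrict_ell2.rep_eq plus_ell2.rep_eq scaleC.rep_eq ell2_fun_ket)
qed

lemma restrict_ell2_tendsto:
  "((\<lambda>F. restrict_ell2 F f) \<longlongrightarrow> f) (finite_subsets_at_top UNIV)"
proof -
  let ?c = "\<lambda>v. (cmod (ell2_fun f v))\<^sup>2"
  have "((\<lambda>F. (norm f)\<^sup>2 - sum ?c F) \<longlongrightarrow> (norm f)\<^sup>2 - (norm f)\<^sup>2) (finite_subsets_at_top UNIV)"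
    using has_sum_infsum[OF summable_norm_ell2[of f]]
    by (intro tendsto_diff tendsto_const) (simp add: norm_ell2_square has_sum_def)
  then have lim: "((\<lambda>F. (norm f)\<^sup>2 - sum ?c F) \<longlongrightarrow> 0) (finite_subsets_at_top UNIV)"
    by simp
  \<comment> \<open>The squared norm of the tail is the total minus the partial sum, so convergence
    in norm is convergence of the series of squares.\<close>
  have eq: "(norm f)\<^sup>2 - sum ?c F = (norm (restrict_ell2 F f - f))\<^sup>2" if "finite F" for F
  proof -
    have "(norm (restrict_ell2 F f - f))\<^sup>2 = (\<Sum>\<^sub>\<infinity>v\<in>UNIV - F. ?c v)"
      by (simp add: norm_minus_commute restrict_ell2_compl norm_restrict_ell2 Compl_eq_Diff_UNIV)
    also have "\<dots> = (norm f)\<^sup>2 - sum ?c F"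
      using that by (subst infsum_Diff) (auto intro: summable_norm_ell2 simp: norm_ell2_square)
    finally show ?thesis ..
  qed
  have "((\<lambda>F. (norm (restrict_ell2 F f - f))\<^sup>2) \<longlongrightarrow> 0) (finite_subsets_at_top UNIV)"
    by (rule Lim_transform_eventually[OF lim]) (rule eventually_finite_subsets_at_top_weakI, rule eq)
  then have "((\<lambda>F. sqrt ((norm (restrict_ell2 F f - f))\<^sup>2)) \<longlongrightarrow> sqrt 0) (finite_subsets_at_top UNIV)"
    by (rule tendsto_real_sqrt)
  then show ?thesis
    by (simp add: tendsto_norm_zero_iff LIM_zero_iff)
qed

lemma ket_expansion: "((\<lambda>v. ell2_fun f v *\<^sub>C ket v) has_sum f) UNIV"
  unfolding has_sum_def
  by (rule Lim_transform_eventually[OF restrict_ell2_tendsto])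
    (simp add: eventually_finite_subsets_at_top_weakI sum_ket_restrict)

lemma obtain_finite_restrict:
  assumes "\<epsilon> > 0"
  obtains F where "finite F" "norm (f - restrict_ell2 F f) < \<epsilon>"
proof -
  have "\<forall>\<^sub>F F in finite_subsets_at_top UNIV. dist (restrict_ell2 F f) f < \<epsilon>"
    using restrict_ell2_tendsto assms by (rule tendstoD)
  then show ?thesis
    using that by (auto simp: eventually_finite_subsets_at_top dist_norm norm_minus_commute)
qed

text \<open>Uniform boundedness reduces every limit below to a computation on basis vectors.\<close>

lemma tendsto_zero_of_ket:
  fixes U :: "nat \<Rightarrow> 'v ell2 \<Rightarrow> 'b::real_normed_vector"
  assumes add: "\<And>n f g. U n (f + g) = U n f + U n g"
    and bound: "\<And>n f. norm (U n f) \<le> C * norm f"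
    and ket: "\<And>c v. (\<lambda>n. U n (c *\<^sub>C ket v)) \<longlonglongrightarrow> 0"
  shows "(\<lambda>n. U n f) \<longlonglongrightarrow> 0"
proof (rule tendstoI)
  fix \<epsilon> :: real
  assume "\<epsilon> > 0"
  \<comment> \<open>\<open>C\<close> may be zero or negative; \<open>K\<close> can safely serve as a
    divisor.\<close>
  define K where "K = max C 1"
  have K: "norm (U n g) \<le> K * norm g" "K > 0" for n g
    using bound[of n g] mult_right_mono[of C K "norm g"] by (auto simp: K_def)
  obtain F where F: "finite F" "norm (f - restrict_ell2 F f) < \<epsilon> / (2 * K)"
    using obtain_finite_restrict[of "\<epsilon> / (2 * K)"] \<open>\<epsilon> > 0\<close> K(2)
    by (metis divide_pos_pos mult_pos_pos zero_less_numeral)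
  have zero: "U n 0 = 0" for n
    using bound[of n 0] by simp
  have "(\<lambda>n. U n (\<Sum>v\<in>F. ell2_fun f v *\<^sub>C ket v)) \<longlonglongrightarrow> 0"
    using F(1)
  proof induction
    case empty
    show ?case by (simp add: zero)
  next
    case (insert x F)
    then show ?case
      using tendsto_add[OF ket insert.IH] by (simp add: add)
  qed
  then have "(\<lambda>n. U n (restrict_ell2 F f)) \<longlonglongrightarrow> 0"
    by (simp add: sum_ket_restrict F(1))
  then have "\<forall>\<^sub>F n in sequentially. norm (U n (restrict_ell2 F f)) < \<epsilon> / 2"
    using \<open>\<epsilon> > 0\<close> by (auto dest: tendstoD[of _ _ _ "\<epsilon> / 2"])
  then show "\<forall>\<^sub>F n in sequentially. dist (U n f) 0 < \<epsilon>"
  proof eventually_elim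
    case (elim n)
    have "norm (U n (f - restrict_ell2 F f)) \<le> K * norm (f - restrict_ell2 F f)"
      by (rule K)
    also have "\<dots> < K * (\<epsilon> / (2 * K))"
      using F(2) K(2) by (rule mult_strict_left_mono)
    finally have "norm (U n (f - restrict_ell2 F f)) < \<epsilon> / 2"
      using K(2) by simp
    moreover have "U n f = U n (f - restrict_ell2 F f) + U n (restrict_ell2 F f)"
      by (simp flip: add)
    ultimately show ?case
      using elim norm_triangle_ineq[of "U n (f - restrict_ell2 F f)" "U n (restrict_ell2 F f)"]
      by simp
  qed
qed

lemma restrict_ell2_exhaust:
  assumes "\<And>v. ell2_fun f v \<noteq> 0 \<Longrightarrow> \<forall>\<^sub>F n in sequentially. v \<in> B n"
  shows "(\<lambda>n. restrict_ell2 (B n) f) \<longlonglongrightarrow> f"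
proof -
  \<comment> \<open>The hypothesis is silent outside the support of \<open>f\<close>. Intersecting
    the remainder with \<open>W\<close> makes the basis vectors there contribute zero, without
    changing the remainder of \<open>f\<close> itself.\<close>
  define W where "W = {v. ell2_fun f v \<noteq> 0}"
  have "(\<lambda>n. restrict_ell2 (W - B n) f) \<longlonglongrightarrow> 0"
  proof (rule tendsto_zero_of_ket[where C = 1])
    fix c v
    have "\<forall>\<^sub>F n in sequentially. restrict_ell2 (W - B n) (c *\<^sub>C ket v) = 0"
    proof (cases "v \<in> W")
      case True
      then have "\<forall>\<^sub>F n in sequentially. v \<in> B n"
        by (intro assms) (simp add: W_def)
      then show ?thesis
        by eventually_elim (simp add: restrict_ell2_scale_ket)
    qed (simp add: restrict_ell2_scale_ket)
    then show "(\<lambda>n. restrict_ell2 (W - B n) (c *\<^sub>C ket v)) \<longlonglongrightarrow> 0"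
      by (rule tendsto_eventually)
  qed (simp_all add: restrict_ell2_add norm_restrict_ell2_le)
  then have "(\<lambda>n. f - restrict_ell2 (W - B n) f) \<longlonglongrightarrow> f - 0"
    by (intro tendsto_diff tendsto_const)
  moreover have "f - restrict_ell2 (W - B n) f = restrict_ell2 (B n) f" for n
    by (rule ell2_eqI) (auto simp: W_def restrict_ell2.rep_eq ell2_fun_minus)
  ultimately show ?thesis
    by simp
qed

section \<open>Contractions, adjoints and orthogonal complements\<close>

lemma contractionI:
  assumes "\<And>f g. T (f + g) = T f + T g" "\<And>c f. T (c *\<^sub>C f) = c *\<^sub>C T f"
    and "\<And>f. norm (T f) \<le> norm f"
  shows "contraction T"
proof -
  have "bounded_linear T"
    by (rule bounded_linear_intro[where K = 1]) (use assms in \<open>auto simp: scaleR_ell2_def\<close>)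
  then show ?thesis
    unfolding contraction_def bounded_clinear_def using assms by (auto intro: onorm_bound)
qed

lemma
  assumes "contraction T"
  shows contraction_add: "T (f + g) = T f + T g"
    and contraction_scale: "T (c *\<^sub>C f) = c *\<^sub>C T f"
    and contraction_norm: "norm (T f) \<le> norm f"
proof -
  from assms have T: "bounded_linear T" "onorm T \<le> 1" and scale: "\<And>c f. T (c *\<^sub>C f) = c *\<^sub>C T f"
    by (auto simp: contraction_def bounded_clinear_def)
  show "T (f + g) = T f + T g"
    by (rule linear_add) (rule bounded_linear.linear[OF T(1)])
  show "T (c *\<^sub>C f) = c *\<^sub>C T f"
    by (rule scale)
  show "norm (T f) \<le> norm f"
    using onorm[OF T(1), of f] mult_right_mono[OF T(2), of "norm f"] by simp
qed

lemma contraction_funpow: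
  assumes "contraction T"
  shows "contraction (T ^^ n)"
proof (induction n)
  case 0
  show ?case by (rule contractionI) auto
next
  case (Suc n)
  show ?case
    by (rule contractionI)
      (use Suc assms in \<open>auto simp: contraction_add contraction_scale
        intro: order_trans[OF contraction_norm contraction_norm]\<close>)
qed

section \<open>Existence and contractivity of the adjoint\<close>

lemma contraction_adjoint_vector:
  assumes "contraction T"
  shows "\<exists>h. \<forall>f. cinner (T f) g = cinner f h"
proof -
  \<comment> \<open>These are the coordinates forced on \<open>h\<close> by testing against basis
    vectors.\<close>
  define a where "a = (\<lambda>u. cinner g (T (ket u)))"
  have "sum (\<lambda>v. (cmod (a v))\<^sup>2) F \<le> (norm g)\<^sup>2" if "finite F" for F
  proof -
    \<comment> \<open>Testing \<open>T\<close> on the truncation \<open>f\<close> of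
      \<open>a\<close> gives \<open>(norm f)\<^sup>2 = cinner (T f) g\<close>, at most
      \<open>norm f * norm g\<close>; cancelling \<open>norm f\<close> bounds all partial sums by
      the same constant.\<close>
    define f where "f = (\<Sum>v\<in>F. a v *\<^sub>C ket v)"
    define s where "s = sum (\<lambda>v. (cmod (a v))\<^sup>2) F"
    have "ell2_fun f u = (if u \<in> F then a u else 0)" for u
      using that unfolding f_def
      by (induction F) (auto simp: zero_ell2.rep_eq plus_ell2.rep_eq scaleC.rep_eq ell2_fun_ket)
    then have "(norm f)\<^sup>2 = (\<Sum>\<^sub>\<infinity>v\<in>F. (cmod (a v))\<^sup>2)"
      unfolding norm_ell2_square by (intro infsum_cong_neutral) auto
    then have f: "(norm f)\<^sup>2 = s"
      using that by (simp add: s_def)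
    have "cinner (T f) g = (\<Sum>v\<in>F. a v * cnj (a v))"
      using that unfolding f_def
    proof induction
      case empty
      show ?case
        using contraction_scale[OF assms, of 0 0] by simp
    next
      case (insert x F)
      then show ?case
        by (simp add: assms contraction_add contraction_scale cinner_add_left cinner_scale_left a_def
            flip: cinner_commute)
    qed
    also have "\<dots> = complex_of_real s"
      by (simp add: s_def flip: complex_norm_square)
    finally have "s \<le> norm (T f) * norm g"
      using cmod_cinner_le[of "T f" g] by simp
    also have "\<dots> \<le> norm f * norm g"
      by (intro mult_right_mono contraction_norm assms) auto
    finally have "norm f * norm f \<le> norm f * norm g"
      by (simp add: f[symmetric] power2_eq_square)
    then have "norm f \<le> norm g"
      by (cases "norm f = 0") auto
    then show ?thesis
      by (simp add: f[symmetric] s_def[symmetric])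
  qed
  then have "square_summable a"
    unfolding square_summable_def
    by (intro nonneg_bdd_above_summable_on bdd_aboveI[where M = "(norm g)\<^sup>2"]) auto
  then have a: "ell2_fun (Abs_ell2 a) = a"
    by (simp add: Abs_ell2_inverse)
  let ?U = "\<lambda>f. cinner (T f) g - cinner f (Abs_ell2 a)"
  \<comment> \<open>A sequence constant in \<open>n\<close>: its convergence to 0, reduced to basis
    vectors, says that \<open>?U f\<close> vanishes.\<close>
  have "(\<lambda>n :: nat. ?U f) \<longlonglongrightarrow> 0" for f
  proof (rule tendsto_zero_of_ket[where U = "\<lambda>_. ?U" and C = "norm g + norm (Abs_ell2 a)"])
    fix c v
    have "cinner (T (ket v)) g = cinner (ket v) (Abs_ell2 a)"
      by (simp add: cinner_ket_left a) (simp add: a_def flip: cinner_commute)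
    then have "?U (c *\<^sub>C ket v) = 0"
      by (simp add: assms contraction_scale cinner_scale_left)
    then show "(\<lambda>n :: nat. ?U (c *\<^sub>C ket v)) \<longlonglongrightarrow> 0"
      by simp
  next
    fix f
    have "norm (?U f) \<le> norm (T f) * norm g + norm f * norm (Abs_ell2 a)"
      by (intro order_trans[OF norm_triangle_ineq4] add_mono cmod_cinner_le)
    also have "\<dots> \<le> norm f * norm g + norm f * norm (Abs_ell2 a)"
      by (intro add_mono mult_right_mono contraction_norm[OF assms]) auto
    finally show "norm (?U f) \<le> (norm g + norm (Abs_ell2 a)) * norm f"
      by (simp add: algebra_simps)
  qed (simp add: assms contraction_add cinner_add_left)
  then have "?U f = 0" for f
    by (simp add: LIMSEQ_const_iff)
  then show ?thesis
    by (intro exI[of _ "Abs_ell2 a"]) simp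
qed

lemma cinner_cadjoint:
  assumes "contraction T"
  shows "cinner (T f) g = cinner f (cadjoint T g)"
proof -
  obtain T' where T': "\<forall>f g. cinner (T f) g = cinner f (T' g)"
    using contraction_adjoint_vector[OF assms] by metis
  have "cadjoint T = T'"
    unfolding cadjoint_def
  proof (rule the_equality)
    fix R
    \<comment> \<open>Uniqueness: two candidates have the same inner products with every
      vector.\<close>
    assume "\<forall>f g. cinner (T f) g = cinner f (R g)"
    with T' show "R = T'"
      by (intro ext cinner_ext) metis
  qed (rule T')
  then show ?thesis
    using T' by simp
qed

lemma contraction_cadjoint:
  assumes "contraction T"
  shows "contraction (cadjoint T)"
proof (rule contractionI)
  fix f g and c
  note adj = cinner_cadjoint[OF assms, symmetric]
  show "cadjoint T (f + g) = cadjoint T f + cadjoint T g"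
    by (rule cinner_ext) (simp add: adj cinner_add_right)
  show "cadjoint T (c *\<^sub>C f) = c *\<^sub>C cadjoint T f"
    by (rule cinner_ext) (simp add: adj cinner_scale_right)
  let ?g = "cadjoint T g"
  \<comment> \<open>Testing the adjoint relation at \<open>?g\<close> itself; one factor
    \<open>norm ?g\<close> then cancels.\<close>
  have "(norm ?g)\<^sup>2 = cmod (cinner (T ?g) g)"
    by (simp add: cinner_cadjoint[OF assms] cinner_self norm_power)
  also have "\<dots> \<le> norm ?g * norm g"
    by (intro order_trans[OF cmod_cinner_le] mult_right_mono contraction_norm assms) auto
  finally show "norm ?g \<le> norm g"
    by (cases "norm ?g = 0") (auto simp: power2_eq_square)
qed

lemma cinner_cadjoint_funpow:
  assumes "contraction T"
  shows "cinner ((T ^^ n) f) g = cinner f ((cadjoint T ^^ n) g)"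
proof (induction n arbitrary: g)
  case (Suc n)
  have "cinner ((T ^^ Suc n) f) g = cinner ((T ^^ n) f) (cadjoint T g)"
    by (simp add: cinner_cadjoint[OF assms])
  then show ?case
    by (simp add: Suc.IH funpow_swap1)
qed simp

section \<open>Orthogonal complements\<close>

lemma orth_compl_closed_subspace:
  "closed (orth_compl M)" "complex_ell2.subspace (orth_compl M)"
proof -
  have "orth_compl M = (\<Inter>f\<in>M. cinner f -` {0})"
    by (auto simp: orth_compl_def)
  moreover have "closed (cinner f -` {0})" for f :: "'a ell2"
    by (intro continuous_closed_vimage closed_singleton linear_continuous_at
        bounded_linear_cinner_right)
  ultimately show "closed (orth_compl M)"
    by auto
  show "complex_ell2.subspace (orth_compl M)"
    by (auto simp: complex_ell2.subspace_def orth_compl_def cinner_add_right cinner_scale_right)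
qed

text \<open>The inclusion valid for every set; its converse is derived in
  \<open>orth_compl_stable_subspace\<close> for the generation vectors.\<close>

lemma closure_span_le_orth_compl2:
  "closure (complex_ell2.span M) \<subseteq> orth_compl (orth_compl M)"
proof -
  have "M \<subseteq> orth_compl (orth_compl M)"
    by (auto simp: orth_compl_def) (metis cinner_commute complex_cnj_zero)
  then show ?thesis
    by (intro closure_minimal complex_ell2.span_minimal orth_compl_closed_subspace)
qed

section \<open>The shift and its adjoint on basis vectors\<close>

locale contractive_weighted_shift =
  fixes E :: "('v \<times> 'v) set"
    and lam :: "'v \<Rightarrow> real"
    and S :: "'v ell2 \<Rightarrow> 'v ell2"
  assumes tree: "directed_tree E"
    and shift: "weighted_shift E lam S"
    and contr: "contraction S"
begin

abbreviation par :: "'v \<Rightarrow> 'v" where "par \<equiv> parent E"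

abbreviation adj :: "'v ell2 \<Rightarrow> 'v ell2" where "adj \<equiv> cadjoint S"

lemma contraction_adj_funpow: "contraction (adj ^^ n)"
  by (intro contraction_funpow contraction_cadjoint contr)

lemma parent_eq: "(u, v) \<in> E \<Longrightarrow> par v = u"
  using tree unfolding directed_tree_def parent_def by (blast intro: the_equality)

lemma parent_edge: "\<not> is_root E v \<Longrightarrow> (par v, v) \<in> E"
  using parent_eq by (force simp: is_root_def)

text \<open>The coordinate at \<open>w\<close> is a bounded linear functional, hence passes through
  the possibly infinite sum over the children and keeps at most the term
  \<open>v = w\<close>.\<close>

lemma ell2_fun_shift_ket:
  "ell2_fun (S (ket u)) w = (if (u, w) \<in> E then complex_of_real (lam w) else 0)"
proof -
  have "((\<lambda>v. complex_of_real (lam v) *\<^sub>C ket v) has_sum S (ket u)) (children E u)"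
    using shift by (simp add: weighted_shift_def)
  then have "((\<lambda>v. ell2_fun (complex_of_real (lam v) *\<^sub>C ket v) w) has_sum ell2_fun (S (ket u)) w)
      (children E u)"
    by (rule has_sum_bounded_linear[OF bounded_linear_ell2_fun])
  moreover have "((\<lambda>v. ell2_fun (complex_of_real (lam v) *\<^sub>C ket v) w) has_sum
      (\<Sum>v\<in>{w} \<inter> children E u. ell2_fun (complex_of_real (lam v) *\<^sub>C ket v) w)) (children E u)"
    by (rule has_sum_cong_neutral[THEN iffD1, OF _ _ _ has_sum_finite])
      (auto simp: scaleC.rep_eq ell2_fun_ket)
  ultimately have "ell2_fun (S (ket u)) w =
      (\<Sum>v\<in>{w} \<inter> children E u. ell2_fun (complex_of_real (lam v) *\<^sub>C ket v) w)"
    by (rule has_sum_unique)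
  then show ?thesis
    by (auto simp: children_def scaleC.rep_eq ell2_fun_ket)
qed

text \<open>The matrix of the adjoint is the transpose; since a vertex has at most one parent, each
  of its columns has at most one nonzero entry.\<close>

lemma adj_ket:
  "adj (ket v) = (if is_root E v then 0 else complex_of_real (lam v) *\<^sub>C ket (par v))"
proof (rule ell2_eqI)
  fix u
  have "ell2_fun (adj (ket v)) u = cnj (cinner (S (ket u)) (ket v))"
    by (simp add: cinner_cadjoint[OF contr] cinner_ket_left)
  also have "\<dots> = (if (u, v) \<in> E then complex_of_real (lam v) else 0)"
    by (simp add: cinner_ket_right ell2_fun_shift_ket)
  finally show "ell2_fun (adj (ket v)) u =
      ell2_fun (if is_root E v then 0 else complex_of_real (lam v) *\<^sub>C ket (par v)) u"
    using parent_eq parent_edge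
    by (auto simp: scaleC.rep_eq zero_ell2.rep_eq ell2_fun_ket is_root_def)
qed

text \<open>The upper bound comes from contractivity of the adjoint, because \<open>lam v\<close> is
  the norm of \<open>adj (ket v)\<close>.\<close>

lemma
  assumes "\<not> is_root E v"
  shows lam_pos: "0 < lam v" and lam_le_1: "lam v \<le> 1"
proof -
  show "0 < lam v"
    using assms shift by (simp add: weighted_shift_def)
  then show "lam v \<le> 1"
    using contraction_norm[OF contraction_cadjoint[OF contr], of "ket v"] assms
    by (simp add: adj_ket norm_scaleC)
qed

section \<open>Stability of the adjoint in a tree with a root\<close>

lemma reachable_from_root:
  assumes "is_root E r"
  shows "(r, v) \<in> E\<^sup>*"
proof -
  have "(r, v) \<in> (E \<union> E\<inverse>)\<^sup>*"
    using tree by (simp add: directed_tree_def)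
  then show ?thesis
  proof induction
    case (step y z)
    show ?case
    proof (cases "(y, z) \<in> E")
      \<comment> \<open>The undirected path goes up from \<open>y\<close> to its parent
        \<open>z\<close>. Uniqueness of parents makes \<open>z\<close> the last vertex before
        \<open>y\<close> on the directed path from \<open>r\<close>, so that path is cut by one
        edge.\<close>
      case False
      with step.hyps have "(z, y) \<in> E" by auto
      moreover have "y \<noteq> r"
        using assms \<open>(z, y) \<in> E\<close> by (auto simp: is_root_def)
      ultimately show ?thesis
        using step.IH parent_eq by (metis rtranclE)
    qed (use step.IH in auto)
  qed auto
qed

lemma adj_stable_if_root:
  assumes "is_root E r"
  shows "is_stable adj"
proof -
  have ket: "(\<lambda>n. (adj ^^ n) (c *\<^sub>C ket v)) \<longlonglongrightarrow> 0" for c v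
    \<comment> \<open>Induction along the path from the root: each application of \<open>adj\<close>
      moves one vertex up and multiplies the scalar by a weight, so \<open>c\<close> has to vary. At
      the root the vector is annihilated.\<close>
    using reachable_from_root[OF assms, of v]
  proof (induction arbitrary: c)
    case base
    have "(adj ^^ Suc n) (c *\<^sub>C ket r) = 0" for n
      using contraction_scale[OF contraction_adj_funpow, of n 0 0] assms
      by (simp add: funpow_swap1 adj_ket contraction_scale[OF contraction_cadjoint[OF contr]])
    then have "(\<lambda>n. (adj ^^ Suc n) (c *\<^sub>C ket r)) \<longlonglongrightarrow> 0"
      by simp
    then show ?case
      by (rule filterlim_sequentially_Suc[THEN iffD1])
  next
    case (step y z)
    then have "\<not> is_root E z" "par z = y"
      using parent_eq by (auto simp: is_root_def)
    then have "(adj ^^ Suc n) (c *\<^sub>C ket z) = (adj ^^ n) ((c * lam z) *\<^sub>C ket y)" for n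
      by (simp add: funpow_swap1 adj_ket contraction_scale[OF contraction_cadjoint[OF contr]])
    then have "(\<lambda>n. (adj ^^ Suc n) (c *\<^sub>C ket z)) \<longlonglongrightarrow> 0"
      using step.IH by (simp del: funpow.simps)
    then show ?case
      by (rule filterlim_sequentially_Suc[THEN iffD1])
  qed
  have "(\<lambda>n. (adj ^^ n) h) \<longlonglongrightarrow> 0" for h
    by (rule tendsto_zero_of_ket[where C = 1])
      (use ket contraction_adj_funpow in \<open>auto simp: contraction_add intro: contraction_norm\<close>)
  then show ?thesis
    by (simp add: is_stable_def contraction_cadjoint contr tendsto_norm_zero)
qed

end

section \<open>Rootless trees\<close>

locale rootless_weighted_shift = contractive_weighted_shift E lam S
  for E :: "('v \<times> 'v) set" and lam S +
  assumes rootless: "\<not> is_root E v"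
begin

section \<open>Generations as classes of vertices sharing an ancestor at equal distance\<close>

lemma edge_iff: "(u, v) \<in> E \<longleftrightarrow> u = par v"
  using parent_eq parent_edge[OF rootless] by auto

lemma children_set_funpow: "(children_set E ^^ n) W = {w. (par ^^ n) w \<in> W}"
proof (induction n)
  case (Suc n)
  then show ?case
    by (auto simp: children_set_def children_def edge_iff funpow_swap1)
qed simp

lemma generation_iff: "w \<in> generation E u \<longleftrightarrow> (\<exists>n. (par ^^ n) w = (par ^^ n) u)"
  by (simp add: generation_def children_set_funpow)

lemma ancestor_mono:
  assumes "(par ^^ n) w = (par ^^ n) u" "n \<le> m"
  shows "(par ^^ m) w = (par ^^ m) u"
proof -
  have "(par ^^ (m - n + n)) w = (par ^^ (m - n + n)) u"
    unfolding funpow_add o_apply assms(1) ..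
  then show ?thesis
    using assms(2) by simp
qed

lemma generation_refl: "u \<in> generation E u"
  by (auto simp: generation_iff)

lemma generation_eq:
  assumes "w \<in> generation E u"
  shows "generation E w = generation E u"
proof -
  obtain n where n: "(par ^^ n) w = (par ^^ n) u"
    using assms by (auto simp: generation_iff)
  \<comment> \<open>Once two vertices share an ancestor at some distance they share all later ones,
    so two such relations are composed at the larger distance.\<close>
  have "(\<exists>m. (par ^^ m) x = (par ^^ m) w) \<longleftrightarrow> (\<exists>m. (par ^^ m) x = (par ^^ m) u)" for x
    using ancestor_mono[OF n] ancestor_mono[of _ x] by (metis max.cobounded1 max.cobounded2)
  then show ?thesis
    by (simp add: set_eq_iff generation_iff)
qed

lemma generation_finite_ancestor:
  assumes "finite F" "F \<subseteq> generation E u"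
  shows "\<exists>n. \<forall>w\<in>F. (par ^^ n) w = (par ^^ n) u"
  using assms
proof induction
  case (insert x F)
  then obtain n m where "\<forall>w\<in>F. (par ^^ n) w = (par ^^ n) u" "(par ^^ m) x = (par ^^ m) u"
    by (auto simp: generation_iff)
  then have "\<forall>w\<in>insert x F. (par ^^ max n m) w = (par ^^ max n m) u"
    using ancestor_mono by (metis insertE max.cobounded1 max.cobounded2)
  then show ?case ..
qed simp

section \<open>Products of weights along ancestor paths\<close>

definition partial_weight :: "nat \<Rightarrow> 'v \<Rightarrow> real" where
  "partial_weight n v = (\<Prod>j<n. lam ((par ^^ j) v))"

definition weight :: "'v \<Rightarrow> real" where
  "weight v = limit_prod (\<lambda>j. lam ((par ^^ j) v))"

lemma partial_weight_pos: "0 < partial_weight n v"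
  by (simp add: partial_weight_def lam_pos rootless prod_pos)

lemma decseq_partial_weight: "decseq (\<lambda>n. partial_weight n v)"
proof (rule decseq_SucI)
  show "partial_weight (Suc n) v \<le> partial_weight n v" for n
    using mult_left_mono[OF lam_le_1[OF rootless], of "partial_weight n v" "(par ^^ n) v"]
      partial_weight_pos[of n v]
    by (simp add: partial_weight_def)
qed

lemma partial_weight_tendsto: "(\<lambda>n. partial_weight n v) \<longlonglongrightarrow> weight v"
proof -
  have "\<bar>partial_weight n v\<bar> \<le> 1" for n
    using decseqD[OF decseq_partial_weight, of 0 n v] partial_weight_pos[of n v]
    by (simp add: partial_weight_def)
  then obtain L where "(\<lambda>n. partial_weight n v) \<longlonglongrightarrow> L"
    using decseq_convergent[OF decseq_partial_weight, of 0 v] partial_weight_pos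
    by (metis less_imp_le)
  then show ?thesis
    by (simp add: weight_def limit_prod_def partial_weight_def[abs_def] limI)
qed

lemma weight_nonneg: "0 \<le> weight v"
  by (rule LIMSEQ_le_const[OF partial_weight_tendsto])
    (use partial_weight_pos in \<open>auto intro: less_imp_le\<close>)

lemma weight_le: "weight v \<le> partial_weight n v"
  by (rule decseq_ge[OF decseq_partial_weight partial_weight_tendsto])

lemma limit_prod_square: "limit_prod (\<lambda>j. (lam ((par ^^ j) v))\<^sup>2) = (weight v)\<^sup>2"
  unfolding limit_prod_def
  by (rule limI) (use tendsto_power[OF partial_weight_tendsto, of v 2] in
      \<open>simp add: partial_weight_def prod_power_distrib\<close>)

lemma partial_weight_add: "partial_weight (m + n) v = partial_weight n v * partial_weight m ((par ^^ n) v)"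
proof (induction m)
  case (Suc m)
  then show ?case
    by (simp add: partial_weight_def funpow_add)
qed (simp add: partial_weight_def)

lemma weight_split: "weight v = partial_weight n v * weight ((par ^^ n) v)"
proof -
  have "(\<lambda>m. partial_weight (m + n) v) \<longlonglongrightarrow> weight v"
    by (rule LIMSEQ_ignore_initial_segment[OF partial_weight_tendsto])
  moreover have "(\<lambda>m. partial_weight (m + n) v) \<longlonglongrightarrow> partial_weight n v * weight ((par ^^ n) v)"
    unfolding partial_weight_add by (intro tendsto_mult_left partial_weight_tendsto)
  ultimately show ?thesis
    by (rule LIMSEQ_unique)
qed

text \<open>By \<open>weight_split\<close> this is the tail of a convergent product with nonzero
  limit, namely the limit divided by the partial products.\<close>

lemma weight_ancestor_tendsto:
  assumes "weight v \<noteq> 0"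
  shows "(\<lambda>n. weight ((par ^^ n) v)) \<longlonglongrightarrow> 1"
proof -
  have "(\<lambda>n. weight v / partial_weight n v) \<longlonglongrightarrow> weight v / weight v"
    by (intro tendsto_divide tendsto_const partial_weight_tendsto assms)
  moreover have "weight v / partial_weight n v = weight ((par ^^ n) v)" for n
    using weight_split[of v n] partial_weight_pos[of n v] by (simp add: field_simps)
  ultimately show ?thesis
    using assms by simp
qed

text \<open>Along an edge the infinite products differ by one positive factor, so nonvanishing
  passes both ways across edges and, by connectedness, to the whole tree.\<close>

lemma weight_nonzero:
  assumes "weight u \<noteq> 0"
  shows "weight v \<noteq> 0"
proof -
  have edge: "weight y \<noteq> 0 \<longleftrightarrow> weight z \<noteq> 0" if "(y, z) \<in> E" for y z
    using that weight_split[of z 1] partial_weight_pos[of 1 z] by (simp add: edge_iff)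
  have "(u, v) \<in> (E \<union> E\<inverse>)\<^sup>*"
    using tree by (simp add: directed_tree_def)
  then show ?thesis
    by induction (use assms edge in auto)
qed

section \<open>Powers of the shift and its adjoint on basis vectors\<close>

lemma adj_funpow_ket:
  "(adj ^^ n) (ket v) = complex_of_real (partial_weight n v) *\<^sub>C ket ((par ^^ n) v)"
proof (induction n)
  case (Suc n)
  then show ?case
    by (simp add: contraction_scale[OF contraction_cadjoint[OF contr]] adj_ket rootless
        partial_weight_def)
qed (simp add: partial_weight_def)

lemma ell2_fun_shift_funpow_ket:
  "ell2_fun ((S ^^ n) (ket u)) w = (if (par ^^ n) w = u then complex_of_real (partial_weight n w) else 0)"
proof -
  have "ell2_fun ((S ^^ n) (ket u)) w = cinner (ket u) ((adj ^^ n) (ket w))"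
    by (simp add: cinner_cadjoint_funpow[OF contr] flip: cinner_ket_right)
  then show ?thesis
    by (simp add: adj_funpow_ket cinner_scale_right cinner_ket_left ell2_fun_ket eq_commute)
qed

text \<open>A finite part of a generation lies among the descendants of a single vertex \<open>x\<close>, where
  the weights are dominated by the coordinates of \<open>S\<^sup>n (ket x)\<close>.\<close>

lemma summable_weight_square: "(\<lambda>v. (weight v)\<^sup>2) summable_on generation E u"
proof (rule nonneg_bdd_above_summable_on)
  show "bdd_above (sum (\<lambda>v. (weight v)\<^sup>2) ` {F. F \<subseteq> generation E u \<and> finite F})"
  proof (rule bdd_aboveI)
    fix s
    assume "s \<in> sum (\<lambda>v. (weight v)\<^sup>2) ` {F. F \<subseteq> generation E u \<and> finite F}"
    then obtain F where F: "finite F" "F \<subseteq> generation E u" "s = (\<Sum>v\<in>F. (weight v)\<^sup>2)"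
      by auto
    obtain n where n: "\<And>w. w \<in> F \<Longrightarrow> (par ^^ n) w = (par ^^ n) u"
      using generation_finite_ancestor[OF F(1,2)] by auto
    let ?f = "(S ^^ n) (ket ((par ^^ n) u))"
    have "s \<le> (\<Sum>v\<in>F. (cmod (ell2_fun ?f v))\<^sup>2)"
      unfolding F(3) using weight_le weight_nonneg n
      by (intro sum_mono power_mono)
        (auto simp: ell2_fun_shift_funpow_ket abs_of_pos partial_weight_pos)
    also have "\<dots> = (norm (restrict_ell2 F ?f))\<^sup>2"
      using F(1) by (simp add: norm_restrict_ell2)
    \<comment> \<open>Contractivity makes the bound independent of \<open>F\<close> and
      \<open>n\<close>.\<close>
    also have "\<dots> \<le> 1"
      using order_trans[OF norm_restrict_ell2_le
          contraction_norm[OF contraction_funpow[OF contr]], of F n "ket ((par ^^ n) u)"]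
      by (simp add: power_le_one)
    finally show "s \<le> 1" .
  qed
qed simp

section \<open>The generation vectors\<close>

lemma
  shows hvec_term_has_sum: "(hvec_term E lam has_sum hvec E lam u) (generation E u)"
    and ell2_fun_hvec: "ell2_fun (hvec E lam u) v =
      (if v \<in> generation E u then complex_of_real (weight v) else 0)"
proof -
  \<comment> \<open>The coordinate function is built first; the expansion of this vector in basis
    vectors then identifies it with the sum defining \<open>hvec\<close>.\<close>
  define a where "a = (\<lambda>v. if v \<in> generation E u then complex_of_real (weight v) else 0)"
  have "(\<lambda>v. (cmod (a v))\<^sup>2) summable_on UNIV"
    by (rule summable_on_cong_neutral[THEN iffD1, OF _ _ _ summable_weight_square[of u]])
      (auto simp: a_def)
  then have a: "ell2_fun (Abs_ell2 a) = a"
    by (simp add: Abs_ell2_inverse square_summable_def)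
  have "((\<lambda>v. a v *\<^sub>C ket v) has_sum Abs_ell2 a) UNIV"
    using ket_expansion[of "Abs_ell2 a"] by (simp add: a)
  then have *: "(hvec_term E lam has_sum Abs_ell2 a) (generation E u)"
    by (rule has_sum_cong_neutral[THEN iffD1, rotated 3]) (auto simp: a_def hvec_term_def weight_def)
  then have "hvec E lam u = Abs_ell2 a"
    by (simp add: hvec_def infsumI)
  with * show "(hvec_term E lam has_sum hvec E lam u) (generation E u)"
    by simp
  show "ell2_fun (hvec E lam u) v = (if v \<in> generation E u then complex_of_real (weight v) else 0)"
    unfolding \<open>hvec E lam u = Abs_ell2 a\<close> a by (simp add: a_def)
qed

lemma norm_hvec: "((\<lambda>v. (weight v)\<^sup>2) has_sum (norm (hvec E lam u))\<^sup>2) (generation E u)"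
proof -
  have "(norm (hvec E lam u))\<^sup>2 = (\<Sum>\<^sub>\<infinity>v\<in>generation E u. (weight v)\<^sup>2)"
    unfolding norm_ell2_square by (rule infsum_cong_neutral) (auto simp: ell2_fun_hvec)
  then show ?thesis
    using has_sum_infsum[OF summable_weight_square] by simp
qed

lemma hvec_eq:
  assumes "v \<in> generation E u"
  shows "hvec E lam v = hvec E lam u"
  by (rule ell2_eqI) (simp add: ell2_fun_hvec generation_eq[OF assms])

lemma hvec_nonzeroE:
  assumes "hvec E lam u \<noteq> 0"
  obtains v where "v \<in> generation E u" "weight v \<noteq> 0"
  using assms that by (metis ell2_eqI ell2_fun_hvec of_real_0 zero_ell2.rep_eq)

lemma hvec_nonzero_weight:
  assumes "hvec E lam u \<noteq> 0"
  shows "weight v \<noteq> 0"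
  using assms hvec_nonzeroE weight_nonzero by metis

lemma hvec_nonzero:
  assumes "hvec E lam u \<noteq> 0"
  shows "hvec E lam v \<noteq> 0"
  using hvec_nonzero_weight[OF assms, of v] ell2_fun_hvec[of v v]
  by (auto simp: generation_refl zero_ell2.rep_eq)

text \<open>Equal vectors agree in the coordinate at \<open>u\<close>; on the left it is
  \<open>weight u\<close>, which is nonzero, so \<open>u\<close> lies in the support on the
  right.\<close>

lemma hvec_eq_iff:
  assumes "hvec E lam u \<noteq> 0"
  shows "hvec E lam u = hvec E lam v \<longleftrightarrow> u \<in> generation E v"
proof
  assume "hvec E lam u = hvec E lam v"
  then show "u \<in> generation E v"
    using hvec_nonzero_weight[OF assms, of u] ell2_fun_hvec[of u u] ell2_fun_hvec[of v u]
    by (simp add: generation_refl split: if_splits)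
qed (rule hvec_eq)

section \<open>The asymptotic limit\<close>

definition asym_iter :: "nat \<Rightarrow> 'v ell2 \<Rightarrow> 'v ell2" where
  "asym_iter n f = (S ^^ n) ((adj ^^ n) f)"

lemma contraction_asym_iter: "contraction (asym_iter n)"
proof (rule contractionI)
  note S = contraction_funpow[OF contr, of n] and A = contraction_adj_funpow[of n]
  show "asym_iter n (f + g) = asym_iter n f + asym_iter n g" for f g
    by (simp add: asym_iter_def contraction_add[OF S] contraction_add[OF A])
  show "asym_iter n (c *\<^sub>C f) = c *\<^sub>C asym_iter n f" for c f
    by (simp add: asym_iter_def contraction_scale[OF S] contraction_scale[OF A])
  show "norm (asym_iter n f) \<le> norm f" for f
    unfolding asym_iter_def by (rule order_trans[OF contraction_norm[OF S] contraction_norm[OF A]])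
qed

text \<open>With \<open>f = g\<close> this is the squared norm of \<open>(adj ^^ n) f\<close>, which
  ties stability to limits of \<open>asym_iter\<close>.\<close>

lemma cinner_asym_iter: "cinner (asym_iter n f) g = cinner ((adj ^^ n) f) ((adj ^^ n) g)"
  by (simp add: asym_iter_def cinner_cadjoint_funpow[OF contr])

lemma asym_ket: "(\<lambda>n. asym_iter n (ket v)) \<longlonglongrightarrow> complex_of_real (weight v) *\<^sub>C hvec E lam v"
proof (cases "weight v = 0")
  case True
  \<comment> \<open>\<open>S ^^ n\<close> does not increase the norm
    \<open>partial_weight n v\<close> of \<open>(adj ^^ n) (ket v)\<close>, and this norm tends to
    0.\<close>
  have le: "norm (asym_iter n (ket v)) \<le> partial_weight n v" for n
    using contraction_norm[OF contraction_funpow[OF contr], of n "(adj ^^ n) (ket v)"]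
      partial_weight_pos[of n v]
    by (simp add: asym_iter_def adj_funpow_ket norm_scaleC)
  have "(\<lambda>n. asym_iter n (ket v)) \<longlonglongrightarrow> 0"
    by (rule Lim_null_comparison[OF always_eventually[OF allI[OF le]]
          partial_weight_tendsto[of v, unfolded True]])
  then show ?thesis
    by (simp add: True)
next
  case False
  \<comment> \<open>The descendants, \<open>n\<close> levels down, of the \<open>n\<close>-th
    ancestor of \<open>v\<close>; these sets increase to the generation of \<open>v\<close>.\<close>
  let ?B = "\<lambda>n. {w. (par ^^ n) w = (par ^^ n) v}"
  have "(\<lambda>n. complex_of_real (partial_weight n v / weight ((par ^^ n) v)) *\<^sub>C
        restrict_ell2 (?B n) (hvec E lam v)) \<longlonglongrightarrow> complex_of_real (weight v / 1) *\<^sub>C hvec E lam v"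
  proof (intro bounded_bilinear.tendsto[OF bounded_bilinear_scaleC] tendsto_of_real tendsto_divide
      partial_weight_tendsto weight_ancestor_tendsto False restrict_ell2_exhaust)
    fix w
    assume "ell2_fun (hvec E lam v) w \<noteq> 0"
    then obtain n where "(par ^^ n) w = (par ^^ n) v"
      by (auto simp: ell2_fun_hvec generation_iff split: if_splits)
    then have "\<forall>m\<ge>n. w \<in> ?B m"
      using ancestor_mono by blast
    then show "\<forall>\<^sub>F n in sequentially. w \<in> ?B n"
      unfolding eventually_sequentially by (rule exI)
  qed simp
  moreover have "asym_iter n (ket v) = complex_of_real (partial_weight n v / weight ((par ^^ n) v)) *\<^sub>C
      restrict_ell2 (?B n) (hvec E lam v)" for n
  proof (rule ell2_eqI)
    fix w
    have "weight ((par ^^ n) v) \<noteq> 0"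
      using False by (rule weight_nonzero)
    \<comment> \<open>All \<open>w\<close> in \<open>?B n\<close> share the ancestor
      \<open>(par ^^ n) v\<close>, so the coordinate \<open>partial_weight n w\<close> of the
      shifted vector is \<open>weight w\<close> over one common constant.\<close>
    moreover have "weight w = partial_weight n w * weight ((par ^^ n) v)" if "w \<in> ?B n"
      using weight_split[of w n] that by simp
    ultimately show "ell2_fun (asym_iter n (ket v)) w =
        ell2_fun (complex_of_real (partial_weight n v / weight ((par ^^ n) v)) *\<^sub>C
          restrict_ell2 (?B n) (hvec E lam v)) w"
      by (auto simp: asym_iter_def adj_funpow_ket contraction_scale[OF contraction_funpow[OF contr]]
          scaleC.rep_eq ell2_fun_shift_funpow_ket restrict_ell2.rep_eq ell2_fun_hvec generation_iff)
  qed
  ultimately show ?thesis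
    by simp
qed

lemma asym_scale_ket:
  "(\<lambda>n. asym_iter n (c *\<^sub>C ket v)) \<longlonglongrightarrow> (c * complex_of_real (weight v)) *\<^sub>C hvec E lam v"
  using bounded_bilinear.tendsto[OF bounded_bilinear_scaleC tendsto_const[of c] asym_ket[of v]]
  by (simp add: contraction_scale[OF contraction_asym_iter])

lemma asym_hvec:
  "(\<lambda>n. asym_iter n (hvec E lam u)) \<longlonglongrightarrow> complex_of_real ((norm (hvec E lam u))\<^sup>2) *\<^sub>C hvec E lam u"
proof -
  let ?h = "hvec E lam u" and ?G = "generation E u"
  \<comment> \<open>On this generation \<open>asym_iter n\<close> tends on basis vectors to the
    rank-one operator \<open>cinner f ?h *\<^sub>C ?h\<close>. Restricting to \<open>?G\<close>
    removes other generations, whose limits point along other vectors; the value at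
    \<open>?h\<close> gives the eigenvalue.\<close>
  let ?U = "\<lambda>n f. asym_iter n (restrict_ell2 ?G f) - cinner f ?h *\<^sub>C ?h"
  have "(\<lambda>n. ?U n ?h) \<longlonglongrightarrow> 0"
  proof (rule tendsto_zero_of_ket[where U = ?U and C = "1 + (norm ?h)\<^sup>2"])
    fix n f g
    show "?U n (f + g) = ?U n f + ?U n g"
      by (simp add: restrict_ell2_add contraction_add[OF contraction_asym_iter] cinner_add_left
          complex_ell2.scale_left_distrib)
    have "norm (?U n f) \<le> norm (asym_iter n (restrict_ell2 ?G f)) + norm (cinner f ?h *\<^sub>C ?h)"
      by (rule norm_triangle_ineq4)
    also have "\<dots> \<le> norm f + norm f * norm ?h * norm ?h"
      unfolding norm_scaleC
      by (intro add_mono mult_right_mono cmod_cinner_le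
          order_trans[OF contraction_norm[OF contraction_asym_iter] norm_restrict_ell2_le]) simp
    finally show "norm (?U n f) \<le> (1 + (norm ?h)\<^sup>2) * norm f"
      by (simp add: algebra_simps power2_eq_square)
  next
    fix c v
    show "(\<lambda>n. ?U n (c *\<^sub>C ket v)) \<longlonglongrightarrow> 0"
    proof (cases "v \<in> ?G")
      case True
      then have "cinner (c *\<^sub>C ket v) ?h *\<^sub>C ?h = (c * complex_of_real (weight v)) *\<^sub>C hvec E lam v"
        by (simp add: cinner_scale_left cinner_ket_left ell2_fun_hvec hvec_eq)
      then show ?thesis
        using LIM_zero[OF asym_scale_ket[of c v]] True by (simp add: restrict_ell2_scale_ket)
    next
      case False
      have "asym_iter n 0 = 0" for n
        using contraction_norm[OF contraction_asym_iter, of n 0] by simp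
      with False show ?thesis
        by (simp add: restrict_ell2_scale_ket cinner_scale_left cinner_ket_left ell2_fun_hvec)
    qed
  qed
  moreover have "restrict_ell2 ?G ?h = ?h"
    by (rule ell2_eqI) (simp add: restrict_ell2.rep_eq ell2_fun_hvec)
  ultimately show ?thesis
    by (simp only: cinner_self LIM_zero_iff)
qed

lemma asymptotic_limit_hvec:
  "asymptotic_limit_adj S (hvec E lam u) =
    complex_of_real ((norm (hvec E lam u))\<^sup>2) *\<^sub>C hvec E lam u"
  using limI[OF asym_hvec[of u]] by (simp add: asymptotic_limit_adj_def asym_iter_def)

section \<open>The stable subspace and its orthogonal complement\<close>

lemma stable_subspace_adj: "stable_subspace adj = orth_compl (range (hvec E lam))"
proof (intro subset_antisym subsetI)
  fix f
  assume "f \<in> stable_subspace adj"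
  then have f: "(\<lambda>n. norm ((adj ^^ n) f)) \<longlonglongrightarrow> 0"
    by (simp add: stable_subspace_def)
  \<comment> \<open>\<open>cinner (asym_iter n (ket v)) f\<close> has this limit by
    \<open>asym_ket\<close>, but equals an inner product with \<open>(adj ^^ n) f\<close>, which
    tends to 0.\<close>
  have zero: "complex_of_real (weight v) * cinner (hvec E lam v) f = 0" for v
  proof (rule LIMSEQ_unique)
    show "(\<lambda>n. cinner (asym_iter n (ket v)) f) \<longlonglongrightarrow> complex_of_real (weight v) * cinner (hvec E lam v) f"
      unfolding cinner_scale_left[symmetric]
      by (rule bounded_linear.tendsto[OF bounded_linear_cinner_left asym_ket])
    have le: "norm (cinner (asym_iter n (ket v)) f) \<le> norm ((adj ^^ n) f)" for n
    proof -
      have "norm (cinner (asym_iter n (ket v)) f) \<le> norm ((adj ^^ n) (ket v)) * norm ((adj ^^ n) f)"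
        unfolding cinner_asym_iter by (rule cmod_cinner_le)
      also have "\<dots> \<le> 1 * norm ((adj ^^ n) f)"
        using contraction_norm[OF contraction_adj_funpow, of n "ket v"]
        by (intro mult_right_mono) auto
      finally show ?thesis
        by simp
    qed
    show "(\<lambda>n. cinner (asym_iter n (ket v)) f) \<longlonglongrightarrow> 0"
      by (rule Lim_null_comparison[OF always_eventually[OF allI[OF le]] f])
  qed
  \<comment> \<open>A nonzero \<open>hvec E lam u\<close> has \<open>weight u \<noteq> 0\<close>, so
    the scalar can be divided out.\<close>
  have "cinner (hvec E lam u) f = 0" for u
    using zero[of u] hvec_nonzero_weight[of u u] by (cases "hvec E lam u = 0") auto
  then show "f \<in> orth_compl (range (hvec E lam))"
    by (auto simp: orth_compl_def)
next
  fix f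
  assume "f \<in> orth_compl (range (hvec E lam))"
  then have f: "cinner (hvec E lam u) f = 0" for u
    by (auto simp: orth_compl_def)
  \<comment> \<open>On basis vectors the limit is a multiple of a generation vector, to which
    \<open>f\<close> is orthogonal. The quantity is the squared norm of
    \<open>(adj ^^ n) f\<close>.\<close>
  have "(\<lambda>n. cinner (asym_iter n f) f) \<longlonglongrightarrow> 0"
  proof (rule tendsto_zero_of_ket[where U = "\<lambda>n g. cinner (asym_iter n g) f" and C = "norm f"])
    fix n g
    show "norm (cinner (asym_iter n g) f) \<le> norm f * norm g"
      using mult_right_mono[OF contraction_norm[OF contraction_asym_iter, of n g], of "norm f"]
        cmod_cinner_le[of "asym_iter n g" f]
      by (simp add: mult.commute)
  next
    fix c v
    show "(\<lambda>n. cinner (asym_iter n (c *\<^sub>C ket v)) f) \<longlonglongrightarrow> 0"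
      using bounded_linear.tendsto[OF bounded_linear_cinner_left asym_scale_ket[of c v], of f]
      by (simp add: cinner_scale_left f)
  qed (simp add: contraction_add[OF contraction_asym_iter] cinner_add_left)
  then have "(\<lambda>n. sqrt (norm (cinner (asym_iter n f) f))) \<longlonglongrightarrow> sqrt 0"
    by (intro tendsto_real_sqrt tendsto_norm_zero)
  then show "f \<in> stable_subspace adj"
    by (simp add: stable_subspace_def cinner_asym_iter cinner_self norm_power)
qed

text \<open>For \<open>v, w\<close> in one generation, \<open>weight w *\<^sub>C ket v - weight v *\<^sub>C ket w\<close> is orthogonal to
  every generation vector.\<close>

lemma orth_compl2_proportional:
  assumes "g \<in> orth_compl (orth_compl (range (hvec E lam)))" "w \<in> generation E v"
  shows "complex_of_real (weight w) * ell2_fun g v = complex_of_real (weight v) * ell2_fun g w"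
proof -
  let ?x = "complex_of_real (weight w) *\<^sub>C ket v - complex_of_real (weight v) *\<^sub>C ket w"
  have "cinner (hvec E lam u) ?x = 0" for u
    using assms(2) generation_eq[of v u] generation_eq[of w u] generation_eq[of w v] generation_refl[of v]
    by (auto simp: cinner_diff_right cinner_scale_right cinner_ket_right ell2_fun_hvec)
  then have "?x \<in> orth_compl (range (hvec E lam))"
    by (auto simp: orth_compl_def)
  with assms(1) have "cinner ?x g = 0"
    by (auto simp: orth_compl_def)
  then have "cnj (complex_of_real (weight w) * ell2_fun g v) =
      cnj (complex_of_real (weight v) * ell2_fun g w)"
    by (simp add: cinner_diff_left cinner_scale_left cinner_ket_left)
  then show ?thesis
    by (simp only: complex_cnj_cancel_iff)
qed

lemma restrict_generation_in_span:
  assumes "g \<in> orth_compl (orth_compl (range (hvec E lam)))"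
  shows "restrict_ell2 (generation E u) g \<in> complex_ell2.span (range (hvec E lam))"
proof (cases "hvec E lam u = 0")
  case True
  \<comment> \<open>With all weights zero on the generation, its basis vectors are orthogonal to
    every generation vector, so \<open>g\<close> vanishes there.\<close>
  have "ket w \<in> orth_compl (range (hvec E lam))" if "w \<in> generation E u" for w
  proof -
    have "weight w = 0"
      using ell2_fun_hvec[of u w] that True by (simp add: zero_ell2.rep_eq)
    then show ?thesis
      by (auto simp: orth_compl_def cinner_ket_right ell2_fun_hvec)
  qed
  with assms have "cinner (ket w) g = 0" if "w \<in> generation E u" for w
    using that by (auto simp: orth_compl_def)
  then have "restrict_ell2 (generation E u) g = 0"
    by (intro ell2_eqI) (simp add: restrict_ell2.rep_eq zero_ell2.rep_eq cinner_ket_left)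
  then show ?thesis
    by (simp add: complex_ell2.span_zero)
next
  case False
  then have "weight u \<noteq> 0"
    by (rule hvec_nonzero_weight)
  \<comment> \<open>Proportionality fixes the scalar by comparing the coordinates at
    \<open>u\<close>.\<close>
  then have "restrict_ell2 (generation E u) g =
      (ell2_fun g u / complex_of_real (weight u)) *\<^sub>C hvec E lam u"
    using orth_compl2_proportional[OF assms, of _ u]
    by (intro ell2_eqI) (simp add: restrict_ell2.rep_eq scaleC.rep_eq ell2_fun_hvec field_simps)
  then show ?thesis
    by (simp add: complex_ell2.span_scale complex_ell2.span_base)
qed

text \<open>Two generations coincide or are disjoint, so adding a vertex to \<open>F\<close> either
  changes nothing or adds one orthogonal summand.\<close>

lemma restrict_generations_in_span:
  assumes "g \<in> orth_compl (orth_compl (range (hvec E lam)))" "finite F"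
  shows "restrict_ell2 (\<Union>v\<in>F. generation E v) g \<in> complex_ell2.span (range (hvec E lam))"
  using assms(2)
proof induction
  case empty
  have "restrict_ell2 {} g = 0"
    by (rule ell2_eqI) (simp add: restrict_ell2.rep_eq zero_ell2.rep_eq)
  then show ?case
    by (simp add: complex_ell2.span_zero)
next
  case (insert x F)
  let ?W = "\<Union>v\<in>F. generation E v"
  show ?case
  proof (cases "x \<in> ?W")
    case True
    then have "generation E x \<subseteq> ?W"
      using generation_eq by blast
    then show ?thesis
      using insert.IH by (simp add: Un_absorb1)
  next
    case False
    then have "generation E x \<inter> ?W = {}"
      using generation_eq generation_refl by blast
    then have "restrict_ell2 (\<Union>v\<in>insert x F. generation E v) g =
        restrict_ell2 (generation E x) g + restrict_ell2 ?W g"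
      by (intro ell2_eqI) (auto simp: restrict_ell2.rep_eq plus_ell2.rep_eq)
    then show ?thesis
      using insert.IH restrict_generation_in_span[OF assms(1)] by (simp add: complex_ell2.span_add)
  qed
qed

lemma orth_compl_stable_subspace:
  "orth_compl (stable_subspace adj) = closure (complex_ell2.span (range (hvec E lam)))"
  unfolding stable_subspace_adj
proof (intro subset_antisym closure_span_le_orth_compl2 subsetI)
  fix g
  assume g: "g \<in> orth_compl (orth_compl (range (hvec E lam)))"
  show "g \<in> closure (complex_ell2.span (range (hvec E lam)))"
    unfolding closure_approachable
  proof (intro allI impI)
    fix \<epsilon> :: real
    assume "\<epsilon> > 0"
    then obtain F where F: "finite F" "norm (g - restrict_ell2 F g) < \<epsilon>"
      by (rule obtain_finite_restrict)
    \<comment> \<open>Completing \<open>F\<close> to full generations only shrinks the remainder and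
      puts the approximant into the span.\<close>
    let ?W = "\<Union>v\<in>F. generation E v"
    have "F \<subseteq> ?W"
      using generation_refl by auto
    then have "norm (g - restrict_ell2 ?W g) \<le> norm (g - restrict_ell2 F g)"
      unfolding restrict_ell2_compl by (intro norm_restrict_ell2_mono) auto
    with F(2) have "dist (restrict_ell2 ?W g) g < \<epsilon>"
      by (simp add: dist_norm norm_minus_commute)
    then show "\<exists>y\<in>complex_ell2.span (range (hvec E lam)). dist y g < \<epsilon>"
      using restrict_generations_in_span[OF g F(1)] by blast
  qed
qed

end

section \<open>Trees with and without a root combined\<close>

theorem proposition3p3:
  fixes E :: "('v \<times> 'v) set"
    and lam :: "'v \<Rightarrow> real"
    and S :: "'v ell2 \<Rightarrow> 'v ell2"
  assumes "directed_tree E"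
    and "weighted_shift E lam S"
    and "contraction S"
  shows "((\<exists>r. is_root E r) \<longrightarrow> is_stable (cadjoint S)) \<and>
    ((\<nexists>r. is_root E r) \<longrightarrow>
      (\<forall>u. hvec_term E lam summable_on generation E u) \<and>
      orth_compl (stable_subspace (cadjoint S)) =
        closure (complex_ell2.span (range (hvec E lam))) \<and>
      ((\<exists>u. hvec E lam u \<noteq> 0) \<longrightarrow>
        (\<forall>u. hvec E lam u \<noteq> 0) \<and>
        (\<forall>u v. hvec E lam u = hvec E lam v \<longleftrightarrow> u \<in> generation E v) \<and>
        (\<forall>u. asymptotic_limit_adj S (hvec E lam u) =
               complex_of_real ((norm (hvec E lam u))\<^sup>2) *\<^sub>C hvec E lam u \<and>
             ((\<lambda>v. limit_prod (\<lambda>j. (lam ((parent E ^^ j) v))\<^sup>2)) has_sum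
               (norm (hvec E lam u))\<^sup>2) (generation E u))))"
proof (intro conjI impI)
  interpret contractive_weighted_shift E lam S
    using assms by unfold_locales
  assume "\<exists>r. is_root E r"
  then show "is_stable (cadjoint S)"
    using adj_stable_if_root by blast
next
  assume "\<nexists>r. is_root E r"
  then interpret rootless_weighted_shift E lam S
    using assms by unfold_locales auto
  show "\<forall>u. hvec_term E lam summable_on generation E u"
    using hvec_term_has_sum by (auto simp: summable_on_def)
  show "orth_compl (stable_subspace (cadjoint S)) = closure (complex_ell2.span (range (hvec E lam)))"
    by (rule orth_compl_stable_subspace)
  assume "\<exists>u. hvec E lam u \<noteq> 0"
  then show nonzero: "\<forall>u. hvec E lam u \<noteq> 0"
    using hvec_nonzero by blast
  then show "\<forall>u v. hvec E lam u = hvec E lam v \<longleftrightarrow> u \<in> generation E v"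
    by (simp add: hvec_eq_iff)
  show "\<forall>u. asymptotic_limit_adj S (hvec E lam u) =
        complex_of_real ((norm (hvec E lam u))\<^sup>2) *\<^sub>C hvec E lam u \<and>
      ((\<lambda>v. limit_prod (\<lambda>j. (lam ((parent E ^^ j) v))\<^sup>2)) has_sum
        (norm (hvec E lam u))\<^sup>2) (generation E u)"
    by (simp only: asymptotic_limit_hvec limit_prod_square norm_hvec simp_thms)
qed

end
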